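(* Let $a_1,\ldots,a_m,b_1,\ldots,b_n\in\mathbb{Z}_+$ with $m\ge n$. Let $A=[a_i]_{i=1,\ldots,m}$, $B=[b_j]_{j=1,\ldots,n}$ be the corresponding multisets. Assume that the quotient $$Q(q)=\frac{\prod_{i=1}^m(1-q^{a_i})}{\prod_{j=1}^n(1-q^{b_j})}$$ lies in $\mathbb{Z}[q]$. The following are sufficient conditions for $Q(q)$ to have non-negative coefficients: 1. The multiset $$\Delta:=\biguplus_{i=1}^m D(a_i)\setminus\biguplus_{j=1}^n D(b_j)$$ is a disjoint multiset union of sets of the form $p^k\vee I$, where $p$ is a prime, $k\in\mathbb{Z}_+$, and $I$ is a principal lower order ideal of the division lattice $\mathbb{Z}_{\ge 0}$ with $p\notin I$ (equivalently, $I=D(d)$ for some $d$ with $p\nmid d$). 2. The multiset $\Delta$ is a disjoint multiset union of sets $D_k$ such that, for each $k$, either (a) $\omega(D_k)\subset\{0,1\}$, or (b) $D_k=\{d,d'\}$, where $d\prec d'$ and $\omega(d)\le 1$. 3. There exists a bijection $f:\{1,\ldots,n\}\to\{1,\ldots,m\}$ such that $D(b_j)\subseteq D(a_{f(j)})$ (equivalently, $b_j\mid a_{f(j)}$) for all $j\in\{1,\ldots,n\}$. In this case, the corresponding local quotients are non-negative and flat. The following is a sufficient condition for the local quotients in $Q(q)$ to be flat: (i) The multiset $\Delta$ is a disjoint multiset union of sets $D_k$ such that, for each $k$, either (a) $\omega(D_k)\subset\{0,1,2\}$, or (b) $D_k=\{d,d'\}$, where $d\prec d'$ and $\omega(d)\le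 2$. All of these conditions also have a corresponding "local" version, which is generally more useful in examples, because then it is possible to use different criteria for different local quotients.
   Context: $\mathbb{Z}_+$ and $\mathbb{Z}_{\ge 0}$ denote the positive and the non-negative integers. Square brackets denote multisets. For $x\in\mathbb{Z}_+$, $D(x)$ is the set of positive divisors of $x$ and $\omega(x)$ is the number of distinct primes dividing $x$; for a set $S$, $\omega(S)=\{\omega(x):x\in S\}$. $\uplus$ denotes additive (multiplicity-adding) union of multisets and $\setminus$ denotes multiset difference; a "disjoint multiset union" of sets means their additive union. The division lattice is $(\mathbb{Z}_{\ge 0},\mid)$, the non-negative integers ordered by divisibility, with meet the gcd and join $\vee$ the lcm; $p^k\vee I=\{\mathrm{lcm}(p^k,x):x\in I\}$. The relation $d\prec d'$ means that $d'$ covers $d$ in this lattice. A polynomial with integer coefficients is flat if all of its coefficients have absolute value at most $1$; it is called non-negative if its coefficients are non-negative. "Local quotients" are the factors in a decomposition of $Q(q)$ into a product: in 3 they are the factors $\frac{1-q^{a_{f(j)}}}{1-q^{b_j}}$, and in (i) they are the factors $\prod_{x\in D_k}\Phi_x(q)$, where $\Phi_x$ is the cyclotomic polynomial of order $x$. A "local" version of a condition is that condition applied to an individual local quotient.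
   Formalization: Condition 2 is stated only for m = n (locally: 1 not in the multiset), as it fails for a=(1,2), b=(1). In (i), for blocks of type (a) only each Φ_x, x in D_k, is shown flat, not their product, since Φ_2Φ_3 is not flat. Local quotients are taken up to sign. *)

theory Defs
  imports
    Complex_Main
    "HOL-Computational_Algebra.Computational_Algebra"
begin

text \<open>Only used at positive arguments. The ideal generated by \<open>0\<close> is the whole lattice.\<close>

definition divs :: "nat \<Rightarrow> nat set" where
  "divs x = {d. d dvd x}"

definition principal_ideal :: "nat set \<Rightarrow> bool" where
  "principal_ideal I \<longleftrightarrow> (\<exists>d. I = {x. x dvd d})"

definition div_covers :: "nat \<Rightarrow> nat \<Rightarrow> bool" where
  "div_covers d d' \<longleftrightarrow>
     d dvd d' \<and> d \<noteq> d' \<and> (\<forall>e. d dvd e \<and> e dvd d' \<longrightarrow> e = d \<or> e = d')"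

definition omega :: "nat \<Rightarrow> nat" where
  "omega x = card {p. prime p \<and> p dvd x}"

definition flat :: "int poly \<Rightarrow> bool" where
  "flat P \<longleftrightarrow> (\<forall>k. \<bar>coeff P k\<bar> \<le> 1)"

definition nonneg :: "int poly \<Rightarrow> bool" where
  "nonneg P \<longleftrightarrow> (\<forall>k. coeff P k \<ge> 0)"

definition primitive_roots :: "nat \<Rightarrow> complex set" where
  "primitive_roots n = {z. z ^ n = 1 \<and> (\<forall>k. 0 < k \<and> k < n \<longrightarrow> z ^ k \<noteq> 1)}"

text \<open>The cyclotomic polynomial is the monic polynomial with the primitive roots of unity as
  simple roots. It has integer coefficients (lemma \<open>map_poly_cyclotomic\<close> below), so that for
  \<open>n > 0\<close> the description denotes. Note that \<open>cyclotomic 1\<close> is \<open>q - 1\<close>, not \<open>1 - q\<close>.\<close>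

definition cyclotomic :: "nat \<Rightarrow> int poly" where
  "cyclotomic n = (THE P. map_poly of_int P = (\<Prod>z\<in>primitive_roots n. [:- z, 1:]))"

definition Delta :: "nat \<Rightarrow> nat \<Rightarrow> (nat \<Rightarrow> nat) \<Rightarrow> (nat \<Rightarrow> nat) \<Rightarrow> nat multiset" where
  "Delta m n a b = (\<Sum>i=1..m. mset_set (divs (a i))) - (\<Sum>j=1..n. mset_set (divs (b j)))"

text \<open>The same set may occur several times in the family. Finiteness is required because
  \<open>mset_set\<close> of an infinite set is empty.\<close>

definition disjoint_multiset_union :: "nat multiset \<Rightarrow> nat set multiset \<Rightarrow> bool" where
  "disjoint_multiset_union M \<D> \<longleftrightarrow> (\<forall>S\<in>#\<D>. finite S) \<and> M = (\<Sum>S\<in>#\<D>. mset_set S)"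

definition join_ideal :: "nat set \<Rightarrow> bool" where
  "join_ideal S \<longleftrightarrow>
     (\<exists>p k I. prime p \<and> k > 0 \<and> principal_ideal I \<and> p \<notin> I \<and> S = (\<lambda>x. lcm (p ^ k) x) ` I)"

definition omega_block :: "nat \<Rightarrow> nat set \<Rightarrow> bool" where
  "omega_block r S \<longleftrightarrow> omega ` S \<subseteq> {0..r}"

definition cover_block :: "nat \<Rightarrow> nat set \<Rightarrow> bool" where
  "cover_block r S \<longleftrightarrow> (\<exists>d d'. S = {d, d'} \<and> div_covers d d' \<and> omega d \<le> r)"

definition condition_1 :: "nat multiset \<Rightarrow> bool" where
  "condition_1 M \<longleftrightarrow> (\<exists>\<D>. disjoint_multiset_union M \<D> \<and> (\<forall>S\<in>#\<D>. join_ideal S))"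

definition condition_2 :: "nat multiset \<Rightarrow> bool" where
  "condition_2 M \<longleftrightarrow>
     (\<exists>\<D>. disjoint_multiset_union M \<D> \<and> (\<forall>S\<in>#\<D>. omega_block 1 S \<or> cover_block 1 S))"

definition condition_3 :: "nat \<Rightarrow> nat \<Rightarrow> (nat \<Rightarrow> nat) \<Rightarrow> (nat \<Rightarrow> nat) \<Rightarrow> (nat \<Rightarrow> nat) \<Rightarrow> bool" where
  "condition_3 m n a b f \<longleftrightarrow>
     bij_betw f {1..n} {1..m} \<and> (\<forall>j\<in>{1..n}. divs (b j) \<subseteq> divs (a (f j)))"

definition condition_i :: "nat multiset \<Rightarrow> nat set multiset \<Rightarrow> bool" where
  "condition_i M \<D> \<longleftrightarrow>
     disjoint_multiset_union M \<D> \<and> (\<forall>S\<in>#\<D>. omega_block 2 S \<or> cover_block 2 S)"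

text \<open>For a block that is only known to satisfy \<open>omega_block 2\<close>, the flat local quotients are the
  individual cyclotomic polynomials: the product over the whole block need not be flat, as
  \<open>cyclotomic 2 * cyclotomic 3 = 1 + 2q + 2q^2 + q^3\<close> shows.\<close>

definition flat_local_quotients :: "nat set \<Rightarrow> bool" where
  "flat_local_quotients S \<longleftrightarrow>
     (omega_block 2 S \<longrightarrow> (\<forall>x\<in>S. flat (cyclotomic x))) \<and>
     (cover_block 2 S \<longrightarrow> flat (\<Prod>x\<in>S. cyclotomic x))"

text \<open>Condition 3 for the single quotient \<open>(1 - q^a) / (1 - q^b)\<close>, in terms of its
  multiset of cyclotomic factors.\<close>

definition local_condition_3 :: "nat multiset \<Rightarrow> bool" where
  "local_condition_3 M \<longleftrightarrow>
     (\<exists>a b. a > 0 \<and> b > 0 \<and> divs b \<subseteq> divs a \<and> M = mset_set (divs a) - mset_set (divs b))"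


lemma map_poly_of_int_mult:
  "map_poly of_int (P * R) = map_poly of_int P * (map_poly of_int R :: complex poly)"
  by (rule poly_eqI) (simp add: coeff_map_poly coeff_mult)

lemma map_poly_of_int_add:
  "map_poly of_int (P + R) = map_poly of_int P + (map_poly of_int R :: complex poly)"
  by (rule poly_eqI) (simp add: coeff_map_poly)

lemma map_poly_of_int_prod:
  "map_poly of_int (\<Prod>x\<in>A. f x) = (\<Prod>x\<in>A. map_poly of_int (f x) :: complex poly)"
  by (induction A rule: infinite_finite_induct) (simp_all add: map_poly_of_int_mult)

lemma map_poly_of_int_eq_iff:
  "map_poly of_int P = (map_poly of_int R :: complex poly) \<longleftrightarrow> P = R"
  by (auto simp: poly_eq_iff coeff_map_poly)

lemma degree_map_poly_of_int: "degree (map_poly of_int P :: complex poly) = degree P"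
  by (rule degree_map_poly) auto

lemma monic_factor_integral:
  fixes F G :: "int poly" and C :: "complex poly"
  assumes eq: "map_poly of_int F = map_poly of_int G * C" and monic: "lead_coeff G = 1"
  shows "\<exists>H. map_poly of_int H = C"
proof -
  have G0: "G \<noteq> 0" using monic by auto
  obtain q r where qr: "pseudo_divmod F G = (q, r)" by fastforce
  have F: "F = G * q + r" and r: "r = 0 \<or> degree r < degree G"
    using pseudo_divmod[OF G0 qr] monic by simp_all
  let ?h = "map_poly of_int :: int poly \<Rightarrow> complex poly"
  have *: "?h r = ?h G * (C - ?h q)"
    using eq by (simp add: F map_poly_of_int_mult map_poly_of_int_add algebra_simps)
  have "C - ?h q = 0"
  proof (rule ccontr)
    assume ne: "C - ?h q \<noteq> 0"
    have hG: "?h G \<noteq> 0"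
      using G0 map_poly_of_int_eq_iff[of G 0] by simp
    have "degree (?h r) = degree (?h G) + degree (C - ?h q)"
      unfolding * using hG ne by (rule degree_mult_eq)
    hence "\<not> degree r < degree G" by (simp add: degree_map_poly_of_int)
    with r have "r = 0" by simp
    with * hG ne show False by simp
  qed
  thus ?thesis by (intro exI[of _ q]) simp
qed

lemma roots_of_unity_partition:
  assumes "n > 0"
  shows "{z::complex. z ^ n = 1} = (\<Union>d\<in>divs n. primitive_roots d)"
proof (intro equalityI subsetI)
  fix z :: complex assume z: "z \<in> {z. z ^ n = 1}"
  define d where "d = (LEAST d. d > 0 \<and> z ^ d = 1)"
  have d: "d > 0 \<and> z ^ d = 1"
    unfolding d_def by (rule LeastI[of _ n]) (use z assms in auto)
  have least: "z ^ k \<noteq> 1" if "0 < k" "k < d" for k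
    using not_less_Least[of k "\<lambda>d. d > 0 \<and> z ^ d = 1"] that unfolding d_def by auto
  have "z ^ n = z ^ (d * (n div d) + n mod d)" by simp
  also have "\<dots> = z ^ (n mod d)" unfolding power_add power_mult using d by simp
  finally have "z ^ (n mod d) = 1" using z by simp
  hence "n mod d = 0" using least[of "n mod d"] d by auto
  thus "z \<in> (\<Union>d\<in>divs n. primitive_roots d)"
    using d least by (auto simp: divs_def primitive_roots_def)
next
  fix z assume "z \<in> (\<Union>d\<in>divs n. primitive_roots d)"
  then obtain d where "d dvd n" "z ^ d = 1" by (auto simp: divs_def primitive_roots_def)
  thus "z \<in> {z. z ^ n = 1}" by (auto simp: power_mult elim!: dvdE)
qed

lemma primitive_roots_disjoint:
  assumes "0 < d" "0 < e" "d \<noteq> e"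
  shows "primitive_roots d \<inter> primitive_roots e = {}"
  using assms by (cases "d < e") (auto simp: primitive_roots_def)

lemma finite_primitive_roots: "n > 0 \<Longrightarrow> finite (primitive_roots n)"
  by (rule finite_subset[of _ "{z. z ^ n = 1}"])
     (auto simp: primitive_roots_def intro: finite_roots_unity)

lemma finite_divs: "n > 0 \<Longrightarrow> finite (divs n)"
  by (simp add: divs_def)

lemma prod_roots_of_unity:
  assumes n: "n > 0"
  shows "(\<Prod>z | z ^ n = 1. [:- z, 1:]) = (monom 1 n - 1 :: complex poly)"
proof -
  let ?p = "monom 1 n - 1 :: complex poly"
  have "\<not> (poly ?p z = 0 \<and> poly (pderiv ?p) z = 0)" for z
    using n by (auto simp: poly_monom pderiv_diff pderiv_monom zero_power)
  hence "rsquarefree ?p" by (simp add: rsquarefree_roots)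
  moreover have "degree ?p = n"
    using n degree_add_eq_left[of "- 1 :: complex poly" "monom 1 n"] by (simp add: degree_monom_eq)
  hence "lead_coeff ?p = 1" using n by simp
  ultimately show ?thesis
    using complex_poly_decompose_rsquarefree[of ?p] by (simp add: poly_monom)
qed

lemma prod_primitive_roots:
  assumes n: "n > 0"
  shows "(\<Prod>d\<in>divs n. \<Prod>z\<in>primitive_roots d. [:- z, 1:]) = (monom 1 n - 1 :: complex poly)"
proof -
  have pos: "d > 0" if "d \<in> divs n" for d using that n by (auto simp: divs_def dvd_pos_nat)
  have "(\<Prod>d\<in>divs n. \<Prod>z\<in>primitive_roots d. [:- z, 1:]) =
        (\<Prod>z\<in>(\<Union>d\<in>divs n. primitive_roots d). [:- z, 1:])"
    by (subst prod.UNION_disjoint)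
       (auto simp: finite_divs n pos finite_primitive_roots dest: primitive_roots_disjoint[OF pos pos])
  thus ?thesis using n by (simp add: prod_roots_of_unity flip: roots_of_unity_partition)
qed

lemma map_poly_cyclotomic:
  assumes "n > 0"
  shows "map_poly of_int (cyclotomic n) = (\<Prod>z\<in>primitive_roots n. [:- z, 1:])"
proof -
  have ex: "\<exists>P. map_poly of_int P = (\<Prod>z\<in>primitive_roots n. [:- z, 1:])"
    using assms
  proof (induction n rule: less_induct)
    case (less n)
    let ?C = "\<lambda>d. \<Prod>z\<in>primitive_roots d. [:- z, 1:]"
    let ?D = "divs n - {n}"
    have "\<forall>d\<in>?D. \<exists>P. map_poly of_int P = ?C d"
      using less by (auto simp: divs_def dvd_imp_le dvd_pos_nat intro!: less.IH le_neq_implies_less)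
    then obtain P where P: "\<And>d. d \<in> ?D \<Longrightarrow> map_poly of_int (P d) = ?C d" by metis
    let ?G = "\<Prod>d\<in>?D. P d"
    have G: "map_poly of_int ?G = (\<Prod>d\<in>?D. ?C d)"
      by (simp add: map_poly_of_int_prod P)
    have "lead_coeff (map_poly of_int ?G :: complex poly) = 1"
      unfolding G by (simp add: lead_coeff_prod)
    hence "lead_coeff ?G = 1"
      by (simp only: degree_map_poly_of_int coeff_map_poly of_int_0 of_int_eq_1_iff)
    moreover have "map_poly of_int (monom 1 n - 1) = map_poly of_int ?G * ?C n"
    proof -
      have "map_poly of_int (monom 1 n - 1) = (monom 1 n - 1 :: complex poly)"
        by (rule poly_eqI) (simp add: coeff_map_poly)
      also have "\<dots> = (\<Prod>d\<in>divs n. ?C d)" using less.prems by (simp add: prod_primitive_roots)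
      also have "\<dots> = ?C n * (\<Prod>d\<in>?D. ?C d)"
        using less.prems by (intro prod.remove) (auto simp: finite_divs, simp add: divs_def)
      finally show ?thesis unfolding G by (simp add: mult.commute)
    qed
    ultimately show ?case by (intro monic_factor_integral)
  qed
  then obtain P where P: "map_poly of_int P = (\<Prod>z\<in>primitive_roots n. [:- z, 1:])" ..
  show ?thesis
    unfolding cyclotomic_def
    by (rule theI[of _ P]) (use P in \<open>auto simp flip: map_poly_of_int_eq_iff\<close>)
qed

end

theory Submission
  imports Defs
begin

text \<open>
  Comparing orders of vanishing at a primitive \<open>x\<close>-th root of unity shows that \<open>Q\<close> being a
  polynomial forces the divisors of the \<open>b j\<close> to form a submultiset of the divisors of the
  \<open>a i\<close>. Since \<open>q ^ n - 1\<close> is the product of the cyclotomic polynomials over the divisors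
  of \<open>n\<close>, it follows that \<open>Q\<close> is, up to the sign \<open>(-1) ^ (m - n)\<close>, the product of the
  cyclotomic polynomials over \<open>Delta\<close> (lemma \<open>quotient_eq_prod_Delta\<close>). The sign disappears
  when \<open>1\<close> is not in \<open>Delta\<close>, because \<open>1\<close> occurs there \<open>m - n\<close> times. So everything
  reduces to products of cyclotomic polynomials over single blocks.

  Nearly all blocks have one of two shapes, each with an explicit product.

  \<^item> \<open>divs n - divs k\<close> with \<open>k dvd n\<close>: the product is \<open>(q ^ n - 1) / (q ^ k - 1)\<close>, a geometric
    sum in \<open>q ^ k\<close>, so its coefficients are 0 or 1 (lemma \<open>diff_divs_nonneg_flat\<close>).
    This covers the sets \<open>p ^ k \<or> I\<close>, the singletons \<open>{x}\<close> with \<open>omega x = 1\<close> and the covers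
    \<open>{d, p * d}\<close> with \<open>omega d = 1\<close>.
  \<^item> \<open>divs (c * u * v) - divs (c * u) - divs (c * v)\<close> with \<open>u\<close>, \<open>v\<close> coprime: by inclusion and
    exclusion the product is
    \<open>(q ^ (c * u * v) - 1) * (q ^ c - 1) / ((q ^ (c * u) - 1) * (q ^ (c * v) - 1))\<close>.
    In \<open>y = q ^ c\<close> this is \<open>1 - y\<close> times the Hilbert series of the numerical semigroup generated
    by \<open>u\<close> and \<open>v\<close>. A difference of two consecutive values of an indicator function lies between
    -1 and 1, so the product is flat (lemma \<open>diff2_divs_flat\<close>). This covers the singletons
    and the covers with \<open>omega\<close> equal to 2. In the cover \<open>{d, p * d}\<close> with \<open>p dvd d\<close>
    the parameter \<open>u\<close> is \<open>p * p\<close>, which is why \<open>u\<close> and \<open>v\<close> are only assumed coprime.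

  The remaining blocks, \<open>{1}\<close> and the covers \<open>{1, p}\<close>, are \<open>divs 1\<close> and \<open>divs p\<close>. Their
  products \<open>q - 1\<close> and \<open>q ^ p - 1\<close> are flat, but they have a negative coefficient; this is
  why \<open>1\<close> must be excluded in the second condition.
\<close>

section \<open>Products of cyclotomic polynomials over sets of divisors\<close>

lemma prod_cyclotomic_divs:
  assumes "n > 0"
  shows "(\<Prod>d\<in>divs n. cyclotomic d) = monom 1 n - 1"
proof -
  have pos: "d > 0" if "d \<in> divs n" for d
    using that assms by (auto simp: divs_def dvd_pos_nat)
  have "map_poly of_int (\<Prod>d\<in>divs n. cyclotomic d) = (monom 1 n - 1 :: complex poly)"
    by (simp add: map_poly_of_int_prod map_poly_cyclotomic pos prod_primitive_roots assms)
  also have "\<dots> = map_poly of_int (monom 1 n - 1)"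
    by (rule poly_eqI) (simp add: coeff_map_poly)
  finally show ?thesis by (simp only: map_poly_of_int_eq_iff)
qed

lemma monom_minus_1_neq_0:
  assumes "n > 0"
  shows "monom 1 n - 1 \<noteq> (0 :: 'a :: comm_ring_1 poly)"
proof
  assume "monom 1 n - 1 = (0 :: 'a poly)"
  hence "coeff (monom 1 n - 1 :: 'a poly) n = 0" by simp
  thus False using assms by simp
qed

lemma divs_mono: "x dvd y \<Longrightarrow> divs x \<subseteq> divs y"
  by (auto simp: divs_def intro: dvd_trans)

lemma prod_cyclotomic_diff:
  assumes "n > 0" "k dvd n"
  shows "(\<Prod>x\<in>divs n - divs k. cyclotomic x) * (monom 1 k - 1) = monom 1 n - 1"
proof -
  have "k > 0" using assms by (auto intro: Nat.gr0I)
  thus ?thesis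
    using prod.subset_diff[OF divs_mono[OF assms(2)] finite_divs[OF assms(1)], of cyclotomic] assms
    by (simp add: prod_cyclotomic_divs)
qed

text \<open>Inclusion and exclusion: the two subtracted sets meet in the divisors of the gcd, whose
  factor \<open>q ^ gcd k l - 1\<close> would otherwise be divided out twice.\<close>

lemma prod_cyclotomic_diff2:
  assumes "n > 0" "k dvd n" "l dvd n"
  shows "(\<Prod>x\<in>divs n - divs k - divs l. cyclotomic x) * ((monom 1 k - 1) * (monom 1 l - 1)) =
         (monom 1 n - 1) * (monom 1 (gcd k l) - 1)"
proof -
  have pos: "k > 0" "l > 0" using assms by (auto intro: Nat.gr0I)
  have sub: "divs k \<union> divs l \<subseteq> divs n" using assms divs_mono by blast
  have eq: "divs n - divs k - divs l = divs n - (divs k \<union> divs l)" by blast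
  have "divs k \<inter> divs l = divs (gcd k l)" by (auto simp: divs_def)
  hence ui: "(\<Prod>x\<in>divs k \<union> divs l. cyclotomic x) * (monom 1 (gcd k l) - 1) =
      (monom 1 k - 1) * (monom 1 l - 1)"
    using prod.union_inter[OF finite_divs finite_divs, of k l cyclotomic] pos
    by (simp add: prod_cyclotomic_divs)
  have "(\<Prod>x\<in>divs n - divs k - divs l. cyclotomic x) * (\<Prod>x\<in>divs k \<union> divs l. cyclotomic x) =
      monom 1 n - 1"
    using prod.subset_diff[OF sub finite_divs[OF assms(1)], of cyclotomic] assms(1)
    by (simp add: prod_cyclotomic_divs eq)
  thus ?thesis by (metis ui mult.assoc)
qed

section \<open>Two families of flat polynomials\<close>

lemma coeff_sum_monom_multiples:
  assumes "t > 0"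
  shows "coeff (\<Sum>i<k. monom 1 (t * i)) j = (of_bool (\<exists>i<k. t * i = j) :: int)"
proof (cases "\<exists>i<k. t * i = j")
  case True
  then obtain i where i: "i < k" "t * i = j" by blast
  have "coeff (\<Sum>i<k. monom 1 (t * i)) j = (\<Sum>i'<k. if i' = i then 1 else 0 :: int)"
    unfolding coeff_sum by (rule sum.cong) (use i assms in auto)
  thus ?thesis using True i by simp
next
  case False
  have "coeff (\<Sum>i<k. monom 1 (t * i)) j = (\<Sum>i'<k. 0 :: int)"
    unfolding coeff_sum by (rule sum.cong) (use False in auto)
  thus ?thesis using False by simp
qed

lemma geometric_sum_monom:
  "(monom 1 t - 1) * (\<Sum>i<k. monom 1 (t * i)) = (monom 1 (t * k) - 1 :: int poly)"
  using power_diff_1_eq[of "monom 1 t :: int poly" k] by (simp add: monom_power mult.commute)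

lemma geometric_quotient_nonneg_flat:
  fixes R :: "int poly"
  assumes "k > 0" "k dvd n" and R: "R * (monom 1 k - 1) = monom 1 n - 1"
  shows "nonneg R" "flat R"
proof -
  obtain l where l: "n = k * l" using assms by blast
  have "(monom 1 k - 1) * R = (monom 1 k - 1) * (\<Sum>i<l. monom 1 (k * i))"
    using R by (simp only: geometric_sum_monom l mult.commute[of R])
  hence "R = (\<Sum>i<l. monom 1 (k * i))"
    using monom_minus_1_neq_0[OF assms(1), where 'a=int] by simp
  thus "nonneg R" "flat R"
    using assms(1) by (simp_all add: nonneg_def flat_def coeff_sum_monom_multiples)
qed

text \<open>After cancelling \<open>q ^ (c * u) - 1\<close>, the hypothesis says that \<open>R\<close> is \<open>1 - q ^ c\<close> times
  \<open>G / (1 - q ^ (c * v))\<close>, where \<open>G\<close> is the sum of the \<open>q ^ (c * u * i)\<close> with \<open>i < v\<close>. Every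
  element of the semigroup generated by \<open>c * u\<close> and \<open>c * v\<close> is \<open>c * u * i + c * v * l\<close> for
  exactly one pair with \<open>i < v\<close>, because \<open>u\<close> and \<open>v\<close> are coprime. Hence \<open>G / (1 - q ^ (c * v))\<close>
  is the generating function of the semigroup, and a coefficient of \<open>R\<close> is a difference of two
  values of its indicator function. The proof replaces the power series by the
  recursions with step \<open>c * v\<close> that both sides satisfy.\<close>

lemma semigroup_quotient_flat:
  fixes R :: "int poly"
  assumes pos: "c > 0" "u > 0" "v > 0" and cop: "coprime u v"
    and R: "R * ((monom 1 (c * u) - 1) * (monom 1 (c * v) - 1)) =
            (monom 1 (c * u * v) - 1) * (monom 1 c - 1)"
  shows "flat R"
proof -
  let ?G = "\<Sum>i<v. monom 1 (c * u * i) :: int poly"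
  \<comment> \<open>\<open>g\<close> is the support of \<open>G\<close>, and \<open>h\<close> is membership in the semigroup.\<close>
  define g where "g j \<longleftrightarrow> (\<exists>i<v. c * u * i = j)" for j
  define h where "h j \<longleftrightarrow> (\<exists>i<v. \<exists>l. c * u * i + c * v * l = j)" for j
  have "(monom 1 (c * u) - 1) * (R * (monom 1 (c * v) - 1)) =
        R * ((monom 1 (c * u) - 1) * (monom 1 (c * v) - 1))" by (rule mult.left_commute)
  also have "\<dots> = (monom 1 (c * u) - 1) * ?G * (monom 1 c - 1)"
    by (simp only: R geometric_sum_monom)
  also have "\<dots> = (monom 1 (c * u) - 1) * (?G * (monom 1 c - 1))" by (rule mult.assoc)
  finally have eq: "R * (monom 1 (c * v) - 1) = ?G * (monom 1 c - 1)"
    using monom_minus_1_neq_0[of "c * u", where 'a=int] pos by simp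
  have G: "coeff ?G j = of_bool (g j)" for j
    using coeff_sum_monom_multiples[of "c * u" v j] pos by (simp add: g_def)
  have rec_R: "coeff R j = (if c * v \<le> j then coeff R (j - c * v) else 0) + of_bool (g j)
      - (if c \<le> j then of_bool (g (j - c)) else 0)" for j
  proof -
    have shift: "coeff (P * (monom 1 k - 1)) j = (if k \<le> j then coeff P (j - k) else 0) - coeff P j"
      for P :: "int poly" and k
      by (simp add: right_diff_distrib mult.commute[of P] coeff_monom_mult)
    from arg_cong[OF eq, of "\<lambda>P. coeff P j"] show ?thesis
      by (simp only: shift G)
  qed
  \<comment> \<open>This is where coprimality enters: it makes the two cases of \<open>rec_h\<close> exclusive, so that
    the indicator functions add.\<close>
  have excl: "\<not> (g j \<and> c * v \<le> j \<and> h (j - c * v))" for j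
  proof
    assume "g j \<and> c * v \<le> j \<and> h (j - c * v)"
    then obtain i' i l where *: "i' < v" "c * u * i' = j" "i < v" "c * v \<le> j"
      "c * u * i + c * v * l = j - c * v" unfolding g_def h_def by blast
    hence "c * (u * i') = c * (u * i + v * (l + 1))" by (simp add: algebra_simps)
    hence e: "u * i' = u * i + v * (l + 1)" using pos by simp
    hence "u * (i' - i) = v * (l + 1)" by (simp add: diff_mult_distrib2)
    hence "v dvd u * (i' - i)" by simp
    hence "v dvd i' - i" using cop by (simp add: coprime_dvd_mult_right_iff coprime_commute)
    hence "i' \<le> i" using * by (auto dest: dvd_imp_le)
    hence "u * i' \<le> u * i" by simp
    thus False using e pos by simp
  qed
  have rec_h: "h j \<longleftrightarrow> g j \<or> (c * v \<le> j \<and> h (j - c * v))" for j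
  proof
    assume "h j"
    then obtain i l where il: "i < v" "c * u * i + c * v * l = j" unfolding h_def by blast
    show "g j \<or> (c * v \<le> j \<and> h (j - c * v))"
    proof (cases l)
      case 0 thus ?thesis using il by (auto simp: g_def)
    next
      case (Suc l')
      hence "c * v \<le> j" "c * u * i + c * v * l' = j - c * v"
        using il by (auto simp: algebra_simps)
      thus ?thesis using il unfolding h_def by blast
    qed
  next
    assume "g j \<or> (c * v \<le> j \<and> h (j - c * v))"
    thus "h j"
    proof
      assume "g j" thus ?thesis unfolding g_def h_def by (metis add_0_right mult_0_right)
    next
      assume *: "c * v \<le> j \<and> h (j - c * v)"
      then obtain i l where "i < v" "c * u * i + c * v * l = j - c * v" unfolding h_def by blast
      hence "i < v" "c * u * i + c * v * Suc l = j" using * by (auto simp: algebra_simps)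
      thus ?thesis unfolding h_def by blast
    qed
  qed
  have rec_h':
    "of_bool (h j) = (if c * v \<le> j then of_bool (h (j - c * v)) else 0) + (of_bool (g j) :: int)"
    for j
    using rec_h[of j] excl[of j] by auto
  have "coeff R j = of_bool (h j) - (if c \<le> j then of_bool (h (j - c)) else 0)" for j
  proof (induction j rule: less_induct)
    case (less j)
    have IH: "coeff R (j - c * v) =
        of_bool (h (j - c * v)) - (if c \<le> j - c * v then of_bool (h (j - c * v - c)) else 0)"
      if "c * v \<le> j"
    proof (rule less)
      have "c * v > 0" using pos by simp
      thus "j - c * v < j" using that by linarith
    qed
    have comm: "j - c * v - c = j - c - c * v" by simp
    consider "\<not> c * v \<le> j" | "c * v \<le> j" "\<not> c \<le> j" | "c * v \<le> j" "c \<le> j" by blast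
    thus ?case
    proof cases
      case 1
      hence "\<not> c * v \<le> j - c" by linarith
      thus ?thesis using 1 rec_R[of j] rec_h'[of j] rec_h'[of "j - c"] by simp
    next
      case 2
      hence "\<not> c \<le> j - c * v" by linarith
      thus ?thesis using 2 rec_R[of j] rec_h'[of j] IH by simp
    next
      case 3
      hence "c \<le> j - c * v \<longleftrightarrow> c * v \<le> j - c" by linarith
      thus ?thesis using 3 rec_R[of j] rec_h'[of j] rec_h'[of "j - c"] IH comm by simp
    qed
  qed
  thus ?thesis by (simp add: flat_def)
qed

section \<open>Blocks as differences of divisor sets\<close>

text \<open>A block that omits the divisors of \<open>n div t\<close> is easiest to recognize from the
  complementary divisors \<open>y = n div x\<close> of its elements \<open>x\<close>: omitting the divisors of \<open>n div t\<close>
  means that \<open>t\<close> does not divide \<open>y\<close>. If enough \<open>t\<close> are used, only \<open>y = 1\<close>, or only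
  \<open>y = 1\<close> and \<open>y = p\<close>, remain.\<close>

lemma dvd_cofactor_iff:
  fixes x y t k :: nat
  assumes "x * y = t * k" "t > 0" "k > 0"
  shows "x dvd k \<longleftrightarrow> t dvd y"
proof
  have "x > 0" using assms by (auto intro: Nat.gr0I)
  show "t dvd y" if "x dvd k"
  proof -
    from that obtain z where "k = x * z" by blast
    with assms(1) \<open>x > 0\<close> have "y = t * z" by simp
    thus ?thesis by simp
  qed
  show "x dvd k" if "t dvd y"
  proof -
    from that obtain z where "y = t * z" by blast
    with assms(1,2) have "k = x * z" by simp
    thus ?thesis by simp
  qed
qed

lemma diff_divs_cofactor:
  assumes "t > 0" "k > 0"
  shows "divs (t * k) - divs k = {x. \<exists>y. x * y = t * k \<and> \<not> t dvd y}"
proof (intro equalityI subsetI)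
  fix x assume x: "x \<in> divs (t * k) - divs k"
  then obtain y where y: "x * y = t * k" by (metis DiffD1 divs_def dvdE mem_Collect_eq)
  thus "x \<in> {x. \<exists>y. x * y = t * k \<and> \<not> t dvd y}"
    using x dvd_cofactor_iff[OF y assms] by (auto simp: divs_def)
next
  fix x assume "x \<in> {x. \<exists>y. x * y = t * k \<and> \<not> t dvd y}"
  then obtain y where y: "x * y = t * k" "\<not> t dvd y" by blast
  hence "x dvd t * k" by (metis dvd_triv_left)
  thus "x \<in> divs (t * k) - divs k"
    using y dvd_cofactor_iff[OF y(1) assms] by (simp add: divs_def)
qed

lemma diff2_divs_cofactor:
  assumes "c > 0" "u > 0" "v > 0"
  shows "divs (c * u * v) - divs (c * u) - divs (c * v) =
         {x. \<exists>y. x * y = c * u * v \<and> \<not> u dvd y \<and> \<not> v dvd y}"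
proof -
  have *: "x dvd c * u \<longleftrightarrow> v dvd y" "x dvd c * v \<longleftrightarrow> u dvd y" if "x * y = c * u * v" for x y
    using dvd_cofactor_iff[of x y v "c * u"] dvd_cofactor_iff[of x y u "c * v"] that assms
    by (simp_all add: mult_ac)
  show ?thesis
  proof (intro equalityI subsetI)
    fix x assume x: "x \<in> divs (c * u * v) - divs (c * u) - divs (c * v)"
    then obtain y where "x * y = c * u * v" by (metis DiffD1 divs_def dvdE mem_Collect_eq)
    thus "x \<in> {x. \<exists>y. x * y = c * u * v \<and> \<not> u dvd y \<and> \<not> v dvd y}"
      using x *[of x y] by (auto simp: divs_def)
  next
    fix x assume "x \<in> {x. \<exists>y. x * y = c * u * v \<and> \<not> u dvd y \<and> \<not> v dvd y}"
    then obtain y where y: "x * y = c * u * v" "\<not> u dvd y" "\<not> v dvd y" by blast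
    hence "x dvd c * u * v" by (metis dvd_triv_left)
    thus "x \<in> divs (c * u * v) - divs (c * u) - divs (c * v)"
      using y *[of x y] by (simp add: divs_def)
  qed
qed

lemma singleton_cofactor:
  assumes "\<And>y. y dvd n \<Longrightarrow> P y \<longleftrightarrow> y = (1::nat)"
  shows "{n} = {x. \<exists>y. x * y = n \<and> P y}"
proof (intro equalityI subsetI)
  fix x assume "x \<in> {n}"
  thus "x \<in> {x. \<exists>y. x * y = n \<and> P y}" using assms[of 1] by (auto intro: exI[of _ 1])
next
  fix x assume "x \<in> {x. \<exists>y. x * y = n \<and> P y}"
  then obtain y where y: "x * y = n" "P y" by blast
  hence "y = 1" using assms[of y] by (metis dvd_triv_right)
  thus "x \<in> {n}" using y by simp
qed

lemma pair_cofactor: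
  assumes "p > 0" "\<And>y. y dvd p * d \<Longrightarrow> P y \<longleftrightarrow> y = 1 \<or> y = (p::nat)"
  shows "{d, p * d} = {x. \<exists>y. x * y = p * d \<and> P y}"
proof (intro equalityI subsetI)
  fix x assume "x \<in> {d, p * d}"
  hence "x * p = p * d \<or> x * 1 = p * d" by auto
  moreover have "P 1" "P p" using assms(2)[of 1] assms(2)[of p] by auto
  ultimately show "x \<in> {x. \<exists>y. x * y = p * d \<and> P y}" by blast
next
  fix x assume "x \<in> {x. \<exists>y. x * y = p * d \<and> P y}"
  then obtain y where y: "x * y = p * d" "P y" by blast
  hence "y = 1 \<or> y = p" using assms(2)[of y] by (metis dvd_triv_right)
  thus "x \<in> {d, p * d}" using y(1) assms(1) by (auto simp: mult.commute[of x])
qed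

lemma dvd_eq_1_iff_no_prime:
  fixes y d :: nat
  assumes "y dvd d"
  shows "y = 1 \<longleftrightarrow> (\<forall>r. prime r \<longrightarrow> r dvd d \<longrightarrow> \<not> r dvd y)"
proof
  assume *: "\<forall>r. prime r \<longrightarrow> r dvd d \<longrightarrow> \<not> r dvd y"
  show "y = 1"
  proof (rule ccontr)
    assume "y \<noteq> 1"
    then obtain r where "prime r" "r dvd y" using prime_factor_nat by blast
    thus False using * assms dvd_trans by blast
  qed
qed auto

text \<open>Used for covers \<open>{d, p * d}\<close>: the complementary divisors \<open>1\<close> and \<open>p\<close> are singled out by
  conditions of the form \<open>\<not> t dvd y\<close>, where \<open>t\<close> runs over the primes of \<open>d\<close> other than \<open>p\<close>
  and \<open>p * p\<close>. The last one costs no subtraction if \<open>p\<close> does not divide \<open>d\<close>, by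
  \<open>prime_square_not_dvd\<close> below; so there are never more conditions than primes of \<open>d\<close>.\<close>

lemma dvd_prime_mult_iff:
  fixes y d p :: nat
  assumes "y dvd p * d" "prime p"
  shows "y = 1 \<or> y = p \<longleftrightarrow>
    (\<forall>r. prime r \<longrightarrow> r dvd d \<longrightarrow> r \<noteq> p \<longrightarrow> \<not> r dvd y) \<and> \<not> p * p dvd y"
proof
  have "\<not> p * p dvd p" using assms(2) by (auto dest: dvd_imp_le)
  moreover have "\<not> p * p dvd 1" using assms(2) by auto
  moreover have "\<not> r dvd p" "\<not> r dvd 1" if "prime r" "r \<noteq> p" for r
    using that assms(2) by (auto dest: primes_dvd_imp_eq)
  ultimately show "(\<forall>r. prime r \<longrightarrow> r dvd d \<longrightarrow> r \<noteq> p \<longrightarrow> \<not> r dvd y) \<and> \<not> p * p dvd y"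
    if "y = 1 \<or> y = p" using that by blast
next
  assume *: "(\<forall>r. prime r \<longrightarrow> r dvd d \<longrightarrow> r \<noteq> p \<longrightarrow> \<not> r dvd y) \<and> \<not> p * p dvd y"
  show "y = 1 \<or> y = p"
  proof (cases "p dvd y")
    case True
    then obtain z where z: "y = p * z" by blast
    have "z dvd d" using assms z by (simp add: prime_gt_0_nat)
    moreover have "\<not> r dvd z" if "prime r" "r dvd d" for r
      using that * z by (cases "r = p") auto
    ultimately have "z = 1" using dvd_eq_1_iff_no_prime by blast
    thus ?thesis using z by simp
  next
    case False
    hence "coprime y p" using assms(2) by (simp add: prime_imp_coprime coprime_commute)
    hence "y dvd d" using assms(1) by (simp add: coprime_dvd_mult_right_iff)
    moreover have "\<not> r dvd y" if "prime r" "r dvd d" for r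
      using that * False by (cases "r = p") auto
    ultimately show ?thesis using dvd_eq_1_iff_no_prime by blast
  qed
qed

lemma prime_square_not_dvd:
  fixes y d p :: nat
  assumes "y dvd p * d" "prime p" "\<not> p dvd d"
  shows "\<not> p * p dvd y"
proof
  assume "p * p dvd y"
  hence "p * p dvd p * d" using assms(1) dvd_trans by blast
  thus False using assms(2,3) by (simp add: prime_gt_0_nat)
qed

text \<open>With \<open>I = divs d\<close> and \<open>p\<close> not dividing \<open>d\<close>, the join \<open>p ^ k \<or> I\<close> is \<open>p ^ k\<close> times
  \<open>divs d\<close>: the divisors of \<open>p ^ k * d\<close> that do not divide \<open>p ^ (k - 1) * d\<close>.\<close>

lemma join_ideal_eq_diff_divs:
  assumes "join_ideal S"
  shows "\<exists>n k. n > 0 \<and> k dvd n \<and> S = divs n - divs k"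
proof -
  from assms obtain p k d where p: "prime p" "k > 0" and pd: "\<not> p dvd d"
    and S: "S = (\<lambda>x. lcm (p ^ k) x) ` {x. x dvd d}"
    unfolding join_ideal_def principal_ideal_def by auto
  have d0: "d > 0" using pd by (auto intro: Nat.gr0I)
  obtain l where l: "k = Suc l" using p by (cases k) auto
  have p0: "p > 0" using p by (simp add: prime_gt_0_nat)
  have lcm: "lcm (p ^ k) x = p ^ k * x" if "x dvd d" for x
  proof -
    have "\<not> p dvd x" using that pd dvd_trans by blast
    hence "coprime (p ^ k) x" using p by (simp add: prime_imp_coprime)
    thus ?thesis by (simp add: lcm_coprime)
  qed
  have "S = {x. \<exists>y. x * y = p * (p ^ l * d) \<and> \<not> p dvd y}"
  proof (intro equalityI subsetI)
    fix x assume "x \<in> S"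
    then obtain z where z: "z dvd d" "x = p ^ k * z" using S lcm by auto
    then obtain y where y: "d = z * y" by blast
    have "x * y = p * (p ^ l * d)" using z y l by (simp add: mult_ac)
    moreover have "\<not> p dvd y" using pd y by auto
    ultimately show "x \<in> {x. \<exists>y. x * y = p * (p ^ l * d) \<and> \<not> p dvd y}" by blast
  next
    fix x assume "x \<in> {x. \<exists>y. x * y = p * (p ^ l * d) \<and> \<not> p dvd y}"
    then obtain y where y: "x * y = p ^ k * d" "\<not> p dvd y" by (auto simp: l mult_ac)
    hence "coprime y (p ^ k)" using p by (simp add: prime_imp_coprime coprime_commute)
    moreover have "y dvd p ^ k * d" using y(1) by (metis dvd_triv_right)
    ultimately have "y dvd d" by (simp add: coprime_dvd_mult_right_iff)
    then obtain z where z: "d = y * z" by blast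
    hence "y > 0" using d0 by (auto intro: Nat.gr0I)
    have "x * y = p ^ k * z * y" using y(1) z by (simp only: mult_ac)
    hence "x = p ^ k * z" using \<open>y > 0\<close> by simp
    moreover have "z dvd d" using z by simp
    ultimately show "x \<in> S" using S lcm by (metis (mono_tags, lifting) imageI mem_Collect_eq)
  qed
  also have "\<dots> = divs (p * (p ^ l * d)) - divs (p ^ l * d)"
    using diff_divs_cofactor[of p "p ^ l * d"] p0 d0 by simp
  finally show ?thesis
    using p0 d0 by (intro exI[of _ "p * (p ^ l * d)"] exI[of _ "p ^ l * d"]) simp
qed

lemma div_covers_prime:
  assumes "div_covers d d'" "d' > 0"
  shows "\<exists>p. prime p \<and> d' = p * d"
proof -
  obtain k where k: "d' = d * k" using assms by (auto simp: div_covers_def)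
  have "k \<noteq> 1" using assms k by (auto simp: div_covers_def)
  then obtain p where p: "prime p" "p dvd k" using prime_factor_nat by blast
  have "d > 0" using assms(2) k by simp
  hence "d * p \<noteq> d" using p by auto
  moreover have "d dvd d * p" "d * p dvd d'" using p k by auto
  ultimately have "d * p = d'" using assms(1) unfolding div_covers_def by metis
  thus ?thesis using p by (auto simp: mult.commute)
qed

lemma finite_prime_divisors: "x > 0 \<Longrightarrow> finite {p::nat. prime p \<and> p dvd x}"
  by (rule finite_subset[of _ "divs x"]) (auto simp: divs_def)

lemma omega_0D:
  assumes "x > 0" "omega x = 0"
  shows "x = 1"
proof -
  have "{p. prime p \<and> p dvd x} = {}"
    using assms finite_prime_divisors[of x] by (simp add: omega_def)
  thus ?thesis using prime_factor_nat by blast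
qed

lemma omega_1E:
  assumes "x > 0" "omega x = 1"
  obtains r e where "prime r" "x = r * e" "e > 0"
    "\<forall>p. prime p \<longrightarrow> p dvd x \<longleftrightarrow> p = r"
proof -
  obtain r where r: "{p. prime p \<and> p dvd x} = {r}"
    using assms(2) by (auto simp: omega_def card_1_singleton_iff)
  hence "prime r" "r dvd x" by auto
  then obtain e where "x = r * e" by blast
  moreover have "p dvd x \<longleftrightarrow> p = r" if "prime p" for p using r that by auto
  moreover have "e > 0" using calculation assms(1) by (auto intro: Nat.gr0I)
  ultimately show ?thesis using that \<open>prime r\<close> by blast
qed

lemma omega_2E:
  assumes "x > 0" "omega x = 2"
  obtains r s c where "prime r" "prime s" "r \<noteq> s" "x = c * r * s" "c > 0"
    "\<forall>p. prime p \<longrightarrow> p dvd x \<longleftrightarrow> p = r \<or> p = s"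
proof -
  obtain r s where rs: "{p. prime p \<and> p dvd x} = {r, s}" "r \<noteq> s"
    using assms(2) by (auto simp: omega_def card_2_iff)
  hence *: "prime r" "r dvd x" "prime s" "s dvd x" by auto
  hence "r * s dvd x" using rs(2) by (simp add: divides_mult primes_coprime)
  then obtain c where "x = c * r * s" by (auto simp: dvd_def mult_ac)
  moreover have "p dvd x \<longleftrightarrow> p = r \<or> p = s" if "prime p" for p using rs that by auto
  moreover have "c > 0" using calculation assms(1) by (auto intro: Nat.gr0I)
  ultimately show ?thesis using that * rs(2) by blast
qed

lemma prime_power_singleton_eq_diff_divs:
  assumes "x > 0" "omega x = 1"
  shows "\<exists>k. k dvd x \<and> {x} = divs x - divs k"
proof -
  obtain r e where r: "prime r" "x = r * e" "e > 0"
    "\<forall>p. prime p \<longrightarrow> p dvd x \<longleftrightarrow> p = r"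
    using omega_1E[OF assms] by blast
  have "{x} = {z. \<exists>y. z * y = x \<and> \<not> r dvd y}"
  proof (rule singleton_cofactor)
    fix y assume "y dvd x"
    from dvd_eq_1_iff_no_prime[OF this] show "\<not> r dvd y \<longleftrightarrow> y = 1" using r(1,4) by blast
  qed
  also have "\<dots> = divs x - divs e"
    using diff_divs_cofactor[of r e] r by (simp add: prime_gt_0_nat)
  finally show ?thesis using r(2) by (intro exI[of _ e]) auto
qed

lemma prime_power_cover_eq_diff_divs:
  assumes "d > 0" "omega d = 1" "prime p"
  shows "\<exists>k. k dvd p * d \<and> {d, p * d} = divs (p * d) - divs k"
proof -
  obtain r e where r: "prime r" "d = r * e" "e > 0"
    "\<forall>p. prime p \<longrightarrow> p dvd d \<longleftrightarrow> p = r"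
    using omega_1E[OF assms(1,2)] by blast
  have p0: "p > 0" "r > 0" using assms r by (simp_all add: prime_gt_0_nat)
  show ?thesis
  proof (cases "p = r")
    case True
    have "{d, p * d} = {z. \<exists>y. z * y = p * d \<and> \<not> p * p dvd y}"
    proof (rule pair_cofactor[OF p0(1)])
      fix y assume "y dvd p * d"
      from dvd_prime_mult_iff[OF this assms(3)] show "\<not> p * p dvd y \<longleftrightarrow> y = 1 \<or> y = p"
        using r(4) True by blast
    qed
    also have "\<dots> = divs (p * d) - divs e"
      using diff_divs_cofactor[of "p * p" e] r True p0 by (simp add: mult.assoc)
    finally show ?thesis using r(2) by (intro exI[of _ e]) auto
  next
    case False
    hence np: "\<not> p dvd d" using r(4) assms by blast
    have "{d, p * d} = {z. \<exists>y. z * y = p * d \<and> \<not> r dvd y}"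
    proof (rule pair_cofactor[OF p0(1)])
      fix y assume y: "y dvd p * d"
      show "\<not> r dvd y \<longleftrightarrow> y = 1 \<or> y = p"
        using dvd_prime_mult_iff[OF y assms(3)] prime_square_not_dvd[OF y assms(3) np]
          r(1,4) False by blast
    qed
    also have "\<dots> = divs (p * d) - divs (p * e)"
      using diff_divs_cofactor[of r "p * e"] r p0 by (simp add: mult_ac)
    finally show ?thesis using r(2) by (intro exI[of _ "p * e"]) auto
  qed
qed

lemma two_primes_singleton_eq_diff2_divs:
  assumes "x > 0" "omega x = 2"
  shows "\<exists>c u v. c > 0 \<and> u > 0 \<and> v > 0 \<and> coprime u v \<and>
           {x} = divs (c * u * v) - divs (c * u) - divs (c * v)"
proof -
  obtain r s c where r: "prime r" "prime s" "r \<noteq> s" "x = c * r * s" "c > 0"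
    "\<forall>p. prime p \<longrightarrow> p dvd x \<longleftrightarrow> p = r \<or> p = s"
    using omega_2E[OF assms] by blast
  have pos: "r > 0" "s > 0" using r by (simp_all add: prime_gt_0_nat)
  have "{x} = {z. \<exists>y. z * y = x \<and> \<not> r dvd y \<and> \<not> s dvd y}"
  proof (rule singleton_cofactor)
    fix y assume "y dvd x"
    from dvd_eq_1_iff_no_prime[OF this] show "\<not> r dvd y \<and> \<not> s dvd y \<longleftrightarrow> y = 1"
      using r(1,2,6) by blast
  qed
  also have "\<dots> = divs (c * r * s) - divs (c * r) - divs (c * s)"
    unfolding diff2_divs_cofactor[OF r(5) pos] r(4) ..
  finally show ?thesis using r(5) pos primes_coprime[OF r(1-3)] by blast
qed

text \<open>Let \<open>r\<close>, \<open>s\<close> be the primes of \<open>d = c * r * s\<close>. If \<open>p\<close> is a third prime, then the parameters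
  are \<open>p * c\<close>, \<open>r\<close> and \<open>s\<close>; if \<open>p = r\<close>, they are \<open>c\<close>, \<open>r * r\<close> and \<open>s\<close>.\<close>

lemma two_primes_cover_eq_diff2_divs:
  assumes "d > 0" "omega d = 2" "prime p"
  shows "\<exists>c u v. c > 0 \<and> u > 0 \<and> v > 0 \<and> coprime u v \<and>
           {d, p * d} = divs (c * u * v) - divs (c * u) - divs (c * v)"
proof -
  obtain r s c where r: "prime r" "prime s" "r \<noteq> s" "d = c * r * s"
    "c > 0" "\<forall>p. prime p \<longrightarrow> p dvd d \<longleftrightarrow> p = r \<or> p = s"
    using omega_2E[OF assms(1,2)] by blast
  have pos: "p > 0" "r > 0" "s > 0" using assms r by (simp_all add: prime_gt_0_nat)
  show ?thesis
  proof (cases "p dvd d")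
    case False
    hence ne: "p \<noteq> r" "p \<noteq> s" using r(6) assms(3) by blast+
    have pc: "p * c > 0" using pos r(5) by simp
    have "{d, p * d} = {z. \<exists>y. z * y = p * d \<and> \<not> r dvd y \<and> \<not> s dvd y}"
    proof (rule pair_cofactor[OF pos(1)])
      fix y assume y: "y dvd p * d"
      show "\<not> r dvd y \<and> \<not> s dvd y \<longleftrightarrow> y = 1 \<or> y = p"
        using dvd_prime_mult_iff[OF y assms(3)] prime_square_not_dvd[OF y assms(3) False]
          r(1,2,6) ne by blast
    qed
    also have "p * d = p * c * r * s" using r(4) by simp
    also note diff2_divs_cofactor[OF pc pos(2,3), symmetric]
    finally have "{d, p * d} = divs (p * c * r * s) - divs (p * c * r) - divs (p * c * s)"
      using r(4) by (simp add: mult_ac)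
    thus ?thesis using pc pos primes_coprime[OF r(1-3)] by blast
  next
    case True
    \<comment> \<open>By symmetry only one of the two primes of \<open>d\<close> has to be treated as \<open>p\<close>.\<close>
    have *: "\<exists>c u v. c > 0 \<and> u > 0 \<and> v > 0 \<and> coprime u v \<and>
           {d, p * d} = divs (c * u * v) - divs (c * u) - divs (c * v)"
      if s: "prime s" "p \<noteq> s" "d = c * p * s" "\<forall>r. prime r \<longrightarrow> r dvd d \<longleftrightarrow> r = p \<or> r = s" for s
    proof -
      have p2: "p * p > 0" "s > 0" using pos s(1) by (simp_all add: prime_gt_0_nat)
      have "{d, p * d} = {z. \<exists>y. z * y = p * d \<and> \<not> p * p dvd y \<and> \<not> s dvd y}"
      proof (rule pair_cofactor[OF pos(1)])
        fix y assume y: "y dvd p * d"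
        show "\<not> p * p dvd y \<and> \<not> s dvd y \<longleftrightarrow> y = 1 \<or> y = p"
          using dvd_prime_mult_iff[OF y assms(3)] s(1,2,4) by blast
      qed
      also have "p * d = c * (p * p) * s" using s(3) by simp
      also note diff2_divs_cofactor[OF r(5) p2, symmetric]
      finally have "{d, p * d} = divs (c * (p * p) * s) - divs (c * (p * p)) - divs (c * s)"
        using s(3) by (simp add: mult_ac)
      moreover have "coprime (p * p) s" using primes_coprime[OF assms(3) s(1,2)] by simp
      ultimately show ?thesis using r(5) p2 by blast
    qed
    from True have "p = r \<or> p = s" using r(6) assms(3) by blast
    thus ?thesis
    proof
      assume "p = r" thus ?thesis using r by (intro *[of s]) auto
    next
      assume "p = s" thus ?thesis using r by (intro *[of r]) (auto simp: mult_ac)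
    qed
  qed
qed

section \<open>Non-negativity and flatness of blocks\<close>

lemma diff_divs_nonneg_flat:
  assumes "n > 0" "k dvd n"
  shows "nonneg (\<Prod>x\<in>divs n - divs k. cyclotomic x)" "flat (\<Prod>x\<in>divs n - divs k. cyclotomic x)"
proof -
  have "k > 0" using assms by (auto intro: Nat.gr0I)
  from geometric_quotient_nonneg_flat[OF this assms(2) prod_cyclotomic_diff[OF assms]]
  show "nonneg (\<Prod>x\<in>divs n - divs k. cyclotomic x)" "flat (\<Prod>x\<in>divs n - divs k. cyclotomic x)"
    by auto
qed

lemma diff2_divs_flat:
  assumes "c > 0" "u > 0" "v > 0" "coprime u v"
  shows "flat (\<Prod>x\<in>divs (c * u * v) - divs (c * u) - divs (c * v). cyclotomic x)"
proof (rule semigroup_quotient_flat[OF assms])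
  have "gcd (c * u) (c * v) = c"
    using assms(4) by (simp add: gcd_mult_distrib_nat[symmetric])
  thus "(\<Prod>x\<in>divs (c * u * v) - divs (c * u) - divs (c * v). cyclotomic x) *
      ((monom 1 (c * u) - 1) * (monom 1 (c * v) - 1)) = (monom 1 (c * u * v) - 1) * (monom 1 c - 1)"
    using prod_cyclotomic_diff2[of "c * u * v" "c * u" "c * v"] assms by (simp add: mult_ac)
qed

lemma flat_prod_divs: "n > 0 \<Longrightarrow> flat (\<Prod>x\<in>divs n. cyclotomic x)"
  by (simp add: prod_cyclotomic_divs flat_def)

lemma flat_cyclotomic:
  assumes "x > 0" "omega x \<le> 2"
  shows "flat (cyclotomic x)"
proof -
  consider "omega x = 0" | "omega x = 1" | "omega x = 2" using assms(2) by linarith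
  hence "flat (\<Prod>y\<in>{x}. cyclotomic y)"
  proof cases
    case 1
    hence "x = 1" using omega_0D assms by blast
    hence "{x} = divs x" by (auto simp: divs_def)
    thus ?thesis using flat_prod_divs assms by metis
  next
    case 2
    thus ?thesis using prime_power_singleton_eq_diff_divs diff_divs_nonneg_flat assms by metis
  next
    case 3
    thus ?thesis using two_primes_singleton_eq_diff2_divs diff2_divs_flat assms by metis
  qed
  thus ?thesis by simp
qed

lemma flat_cover:
  assumes "d > 0" "prime p" "omega d \<le> 2"
  shows "flat (\<Prod>x\<in>{d, p * d}. cyclotomic x)"
proof -
  have pd: "p * d > 0" using assms by (simp add: prime_gt_0_nat)
  consider "omega d = 0" | "omega d = 1" | "omega d = 2" using assms(3) by linarith
  thus ?thesis
  proof cases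
    case 1
    hence "d = 1" using omega_0D assms by blast
    hence "{d, p * d} = divs (p * d)" using assms(2) by (auto simp: divs_def prime_nat_iff)
    thus ?thesis using flat_prod_divs[OF pd] by metis
  next
    case 2
    thus ?thesis using prime_power_cover_eq_diff_divs diff_divs_nonneg_flat(2)[OF pd] assms by metis
  next
    case 3
    thus ?thesis using two_primes_cover_eq_diff2_divs diff2_divs_flat assms by metis
  qed
qed

text \<open>A bound on \<open>omega\<close> alone would admit the element \<open>0\<close>: the set of primes dividing it is
  infinite, so that \<open>omega 0 = 0\<close>.\<close>

lemma flat_local_quotients_if_pos:
  assumes "\<And>x. x \<in> S \<Longrightarrow> x > 0"
  shows "flat_local_quotients S"
  unfolding flat_local_quotients_def
proof (intro conjI impI ballI)
  fix x assume "omega_block 2 S" "x \<in> S"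
  thus "flat (cyclotomic x)"
    using assms by (intro flat_cyclotomic) (auto simp: omega_block_def)
next
  assume "cover_block 2 S"
  then obtain d d' where d: "S = {d, d'}" "div_covers d d'" "omega d \<le> 2"
    by (auto simp: cover_block_def)
  then obtain p where "prime p" "d' = p * d" using div_covers_prime assms by blast
  thus "flat (\<Prod>x\<in>S. cyclotomic x)" using flat_cover[of d p] d assms by simp
qed

lemma nonneg_1: "nonneg 1"
  by (simp add: nonneg_def)

lemma nonneg_mult: "nonneg P \<Longrightarrow> nonneg R \<Longrightarrow> nonneg (P * R)"
  by (simp add: nonneg_def coeff_mult sum_nonneg)

lemma nonneg_prod_mset: "(\<And>x. x \<in># M \<Longrightarrow> nonneg (f x)) \<Longrightarrow> nonneg (\<Prod>x\<in>#M. f x)"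
  by (induction M) (auto intro: nonneg_mult nonneg_1)

lemma nonneg_prod: "(\<And>x. x \<in> A \<Longrightarrow> nonneg (f x)) \<Longrightarrow> nonneg (\<Prod>x\<in>A. f x)"
  by (induction A rule: infinite_finite_induct) (auto intro: nonneg_mult nonneg_1)

lemma nonneg_cyclotomic:
  assumes "x > 1" "omega x \<le> 1"
  shows "nonneg (cyclotomic x)"
proof -
  have "omega x = 1" using assms omega_0D[of x] by linarith
  then obtain k where "k dvd x" "{x} = divs x - divs k"
    using prime_power_singleton_eq_diff_divs[of x] assms by auto
  hence "nonneg (\<Prod>y\<in>{x}. cyclotomic y)" using diff_divs_nonneg_flat(1)[of x k] assms by simp
  thus ?thesis by simp
qed

lemma nonneg_cover:
  assumes "d > 1" "prime p" "omega d \<le> 1"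
  shows "nonneg (\<Prod>x\<in>{d, p * d}. cyclotomic x)"
proof -
  have pd: "p * d > 0" using assms by (simp add: prime_gt_0_nat)
  have "omega d = 1" using assms omega_0D[of d] by linarith
  then obtain k where "k dvd p * d" "{d, p * d} = divs (p * d) - divs k"
    using prime_power_cover_eq_diff_divs[of d p] assms by auto
  thus ?thesis using diff_divs_nonneg_flat(1)[OF pd] by simp
qed

section \<open>Conditions on multisets of cyclotomic factors\<close>

lemma prod_mset_disjoint_multiset_union:
  assumes "disjoint_multiset_union M \<D>"
  shows "(\<Prod>x\<in>#M. f x) = (\<Prod>S\<in>#\<D>. \<Prod>x\<in>S. f x)"
proof -
  have "(\<Prod>x\<in>#(\<Sum>S\<in>#\<D>. mset_set S). f x) = (\<Prod>S\<in>#\<D>. \<Prod>x\<in>S. f x)"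
    by (induction \<D>) (auto simp: prod_unfold_prod_mset)
  thus ?thesis using assms by (simp add: disjoint_multiset_union_def)
qed

lemma set_mset_disjoint_multiset_union:
  assumes "disjoint_multiset_union M \<D>"
  shows "set_mset M = (\<Union>S\<in>set_mset \<D>. S)"
  using assms by (auto simp: disjoint_multiset_union_def)

lemma prod_mset_Union_mset:
  "(\<Prod>x\<in>#\<Sum>\<^sub># \<M>. f x) = (\<Prod>M\<in>#\<M>. \<Prod>x\<in>#M. f x)"
  by (induction \<M>) auto

lemma condition_1_nonneg:
  assumes "condition_1 M"
  shows "nonneg (\<Prod>x\<in>#M. cyclotomic x)"
proof -
  obtain \<D> where D: "disjoint_multiset_union M \<D>" "\<forall>S\<in>#\<D>. join_ideal S"
    using assms by (auto simp: condition_1_def)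
  have "nonneg (\<Prod>x\<in>S. cyclotomic x)" if "S \<in># \<D>" for S
    using D(2) that join_ideal_eq_diff_divs[of S] diff_divs_nonneg_flat(1) by metis
  thus ?thesis
    unfolding prod_mset_disjoint_multiset_union[OF D(1)] by (rule nonneg_prod_mset)
qed

lemma condition_1_not_1:
  assumes "condition_1 M"
  shows "1 \<notin># M"
proof
  assume "1 \<in># M"
  then obtain S where "join_ideal S" "1 \<in> S"
    using assms set_mset_disjoint_multiset_union by (fastforce simp: condition_1_def)
  then obtain p k x where *: "prime p" "k > 0" "lcm (p ^ k) x = (1::nat)"
    unfolding join_ideal_def by (metis imageE)
  hence "p ^ k dvd 1" by (metis dvd_lcm1)
  hence "p = 1" using *(2) by (simp add: nat_power_eq_Suc_0_iff)
  thus False using *(1) by simp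
qed

lemma condition_2_nonneg:
  assumes "condition_2 M" and gt_1: "\<And>x. x \<in># M \<Longrightarrow> x > 1"
  shows "nonneg (\<Prod>x\<in>#M. cyclotomic x)"
proof -
  obtain \<D> where D: "disjoint_multiset_union M \<D>" "\<forall>S\<in>#\<D>. omega_block 1 S \<or> cover_block 1 S"
    using assms by (auto simp: condition_2_def)
  have "nonneg (\<Prod>x\<in>S. cyclotomic x)" if S: "S \<in># \<D>" for S
  proof -
    have gt: "x > 1" if "x \<in> S" for x
      using gt_1 S that set_mset_disjoint_multiset_union[OF D(1)] by blast
    from D(2) S have "omega_block 1 S \<or> cover_block 1 S" by blast
    thus ?thesis
    proof
      assume "omega_block 1 S"
      thus ?thesis using gt by (intro nonneg_prod nonneg_cyclotomic) (auto simp: omega_block_def)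
    next
      assume "cover_block 1 S"
      then obtain d d' where d: "S = {d, d'}" "div_covers d d'" "omega d \<le> 1"
        by (auto simp: cover_block_def)
      then obtain p where "prime p" "d' = p * d"
        using div_covers_prime[of d d'] gt[of d'] by auto
      thus ?thesis using nonneg_cover[of d p] d gt[of d] by simp
    qed
  qed
  thus ?thesis
    unfolding prod_mset_disjoint_multiset_union[OF D(1)] by (rule nonneg_prod_mset)
qed

lemma divs_subset_iff: "divs x \<subseteq> divs y \<longleftrightarrow> x dvd y"
proof
  assume "divs x \<subseteq> divs y"
  moreover have "x \<in> divs x" by (simp add: divs_def)
  ultimately have "x \<in> divs y" by (rule subsetD)
  thus "x dvd y" by (simp add: divs_def)
qed (rule divs_mono)

lemma local_condition_3E:
  assumes "local_condition_3 M"
  obtains a b where "a > 0" "b dvd a" "M = mset_set (divs a - divs b)"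
  using assms that by (metis local_condition_3_def divs_subset_iff finite_divs mset_set_Diff)

lemma local_condition_3_nonneg_flat:
  assumes "local_condition_3 M"
  shows "nonneg (\<Prod>x\<in>#M. cyclotomic x)" "flat (\<Prod>x\<in>#M. cyclotomic x)"
  using assms
  by (auto elim!: local_condition_3E simp: diff_divs_nonneg_flat simp flip: prod_unfold_prod_mset)

lemma local_condition_3_not_1:
  assumes "local_condition_3 M"
  shows "1 \<notin># M"
  using assms by (auto elim!: local_condition_3E simp: finite_divs) (auto simp: divs_def)

lemma condition_i_flat_local_quotients:
  assumes "condition_i M \<D>" "S \<in># \<D>" "\<And>x. x \<in># M \<Longrightarrow> x > 0"
  shows "flat_local_quotients S"
  using assms set_mset_disjoint_multiset_union[of M \<D>]
  by (intro flat_local_quotients_if_pos) (auto simp: condition_i_def)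

section \<open>The cyclotomic factorization of the quotient\<close>

text \<open>The primitive root is \<open>cis (2 * pi / x)\<close>; its powers with exponents below \<open>x\<close> are distinct.\<close>

lemma ex_primitive_root:
  assumes "x > 0"
  shows "\<exists>z::complex. \<forall>k. z ^ k = 1 \<longleftrightarrow> x dvd k"
proof -
  let ?w = "\<lambda>k. cis (2 * pi * real k / real x)"
  have inj: "inj_on ?w {..<x}" using bij_betw_roots_unity[OF assms] by (simp add: bij_betw_def)
  define z where "z = ?w 1"
  have z: "z ^ k = ?w k" for k by (simp add: z_def DeMoivre mult_ac)
  have zx: "z ^ x = 1" using assms by (simp add: z)
  have "z ^ k = 1 \<longleftrightarrow> x dvd k" for k
  proof -
    have "z ^ k = z ^ (x * (k div x) + k mod x)" by simp
    also have "\<dots> = ?w (k mod x)" by (simp only: power_add power_mult zx z[symmetric]) simp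
    finally have "z ^ k = 1 \<longleftrightarrow> ?w (k mod x) = ?w 0" by simp
    also have "\<dots> \<longleftrightarrow> k mod x = 0" using inj assms by (subst inj_on_eq_iff[OF inj]) auto
    finally show ?thesis by (simp add: dvd_eq_mod_eq_0)
  qed
  thus ?thesis by blast
qed

lemma order_one_minus_monom:
  fixes z :: complex
  assumes "n > 0"
  shows "order z (1 - monom 1 n) = of_bool (z ^ n = 1)"
proof -
  let ?p = "1 - monom 1 n :: complex poly"
  have "\<not> (poly ?p w = 0 \<and> poly (pderiv ?p) w = 0)" for w
    using assms by (auto simp: poly_monom pderiv_diff pderiv_monom zero_power)
  hence "rsquarefree ?p" by (simp add: rsquarefree_roots)
  moreover have "?p \<noteq> 0" using monom_minus_1_neq_0[OF assms, where 'a=complex] by auto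
  ultimately have "order z ?p = 0 \<or> order z ?p = 1" "poly ?p z = 0 \<longleftrightarrow> order z ?p \<noteq> 0"
    using order_root[of ?p z] by (auto simp: rsquarefree_def)
  thus ?thesis by (auto simp: poly_monom)
qed

lemma order_prod_one_minus_monom:
  fixes z :: complex
  assumes "finite J" "\<forall>j\<in>J. c j > (0::nat)"
  shows "(\<Prod>j\<in>J. 1 - monom 1 (c j)) \<noteq> (0 :: complex poly) \<and>
         order z (\<Prod>j\<in>J. 1 - monom 1 (c j)) = (\<Sum>j\<in>J. of_bool (z ^ c j = 1))"
  using assms
proof (induction J)
  case (insert j J)
  have "1 - monom 1 (c j) \<noteq> (0 :: complex poly)"
    using insert.prems monom_minus_1_neq_0[of "c j", where 'a=complex] by auto
  thus ?case using insert by (simp add: order_mult order_one_minus_monom)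
qed auto

lemma count_sum_divs:
  assumes "finite J" "\<forall>j\<in>J. c j > 0"
  shows "count (\<Sum>j\<in>J. mset_set (divs (c j))) x = (\<Sum>j\<in>J. of_bool (x dvd c j))"
  using assms by (induction J) (auto simp: finite_divs divs_def count_mset_set')

lemma zero_notin_sum_divs:
  assumes "finite J" "\<forall>j\<in>J. c j > 0"
  shows "0 \<notin># (\<Sum>j\<in>J. mset_set (divs (c j)))"
  using assms by (induction J) (auto simp: finite_divs divs_def)

lemma prod_mset_sum_divs:
  assumes "finite J" "\<forall>j\<in>J. c j > 0"
  shows "(\<Prod>x\<in>#(\<Sum>j\<in>J. mset_set (divs (c j))). cyclotomic x) = (\<Prod>j\<in>J. monom 1 (c j) - 1)"
  using assms by (induction J) (auto simp: prod_cyclotomic_divs simp flip: prod_unfold_prod_mset)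

lemma prod_one_minus_monom:
  "(\<Prod>j=1..n. 1 - monom 1 (c j)) = (-1) ^ n * (\<Prod>j=1..n. monom 1 (c j) - 1 :: int poly)"
  by (induction n) (auto simp: algebra_simps)

context
  fixes a b :: "nat \<Rightarrow> nat" and m n :: nat and Q :: "int poly"
  assumes a: "\<forall>i\<in>{1..m}. a i > 0" and b: "\<forall>j\<in>{1..n}. b j > 0" and mn: "m \<ge> n"
    and Q: "Q * (\<Prod>j=1..n. 1 - monom 1 (b j)) = (\<Prod>i=1..m. 1 - monom 1 (a i))"
begin

text \<open>The number of \<open>j\<close> with \<open>x dvd b j\<close> is the order of the denominator of \<open>Q\<close> at a primitive
  \<open>x\<close>-th root of unity, and likewise for the numerator; the order of a polynomial is at least
  that of any of its divisors.\<close>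

lemma sum_divs_subset:
  "(\<Sum>j=1..n. mset_set (divs (b j))) \<subseteq># (\<Sum>i=1..m. mset_set (divs (a i)))"
proof (rule mset_subset_eqI)
  fix x
  show "count (\<Sum>j=1..n. mset_set (divs (b j))) x \<le> count (\<Sum>i=1..m. mset_set (divs (a i))) x"
  proof (cases "x = 0")
    case True
    thus ?thesis using zero_notin_sum_divs[OF _ b] by (simp add: not_in_iff)
  next
    case False
    then obtain z :: complex where z: "\<And>k. z ^ k = 1 \<longleftrightarrow> x dvd k" using ex_primitive_root[of x] by auto
    let ?h = "map_poly of_int :: int poly \<Rightarrow> complex poly"
    have h: "?h (\<Prod>j=1..l. 1 - monom 1 (c j)) = (\<Prod>j=1..l. 1 - monom 1 (c j))" for c and l :: nat
    proof -
      have "?h (1 - monom 1 k) = 1 - monom 1 k" for k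
        by (rule poly_eqI) (simp add: coeff_map_poly)
      thus ?thesis by (simp add: map_poly_of_int_prod)
    qed
    have eq: "?h Q * (\<Prod>j=1..n. 1 - monom 1 (b j)) = (\<Prod>i=1..m. 1 - monom 1 (a i))"
      using arg_cong[OF Q, of ?h] by (simp only: map_poly_of_int_mult h)
    have A: "(\<Prod>i=1..m. 1 - monom 1 (a i)) \<noteq> (0 :: complex poly)"
      "order z (\<Prod>i=1..m. 1 - monom 1 (a i)) = (\<Sum>i=1..m. of_bool (x dvd a i))"
      and B: "order z (\<Prod>j=1..n. 1 - monom 1 (b j)) = (\<Sum>j=1..n. of_bool (x dvd b j))"
      using order_prod_one_minus_monom[OF _ a, of z] order_prod_one_minus_monom[OF _ b, of z]
      by (simp_all add: z)
    have "order z (\<Prod>j=1..n. 1 - monom 1 (b j)) \<le> order z (\<Prod>i=1..m. 1 - monom 1 (a i))"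
      using A(1) order_mult[of "?h Q" "\<Prod>j=1..n. 1 - monom 1 (b j)" z] unfolding eq by simp
    thus ?thesis
      by (simp only: A(2) B count_sum_divs[OF finite_atLeastAtMost a]
          count_sum_divs[OF finite_atLeastAtMost b])
  qed
qed

text \<open>Multiset difference truncates, so that the divisors of the \<open>b j\<close> cancel only because of
  \<open>sum_divs_subset\<close>.\<close>

lemma quotient_eq_prod_Delta:
  "Q = (-1) ^ (m - n) * (\<Prod>x\<in>#Delta m n a b. cyclotomic x)"
proof -
  let ?A = "\<Prod>i=1..m. monom 1 (a i) - 1 :: int poly"
  let ?B = "\<Prod>j=1..n. monom 1 (b j) - 1 :: int poly"
  let ?D = "\<Prod>x\<in>#Delta m n a b. cyclotomic x"
  have B0: "?B \<noteq> 0"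
    unfolding prod_zero_iff[OF finite_atLeastAtMost] using b monom_minus_1_neq_0 by blast
  have "(\<Sum>i=1..m. mset_set (divs (a i))) = Delta m n a b + (\<Sum>j=1..n. mset_set (divs (b j)))"
    unfolding Delta_def using sum_divs_subset by simp
  from arg_cong[OF this, of "\<lambda>M. \<Prod>x\<in>#M. cyclotomic x"]
  have "?A = ?D * ?B" using a b by (simp add: prod_mset_sum_divs)
  moreover have "Q * ((-1) ^ n * ?B) = (-1) ^ m * ?A"
    using Q by (simp only: prod_one_minus_monom)
  moreover have "(-1) ^ m = (-1) ^ (m - n) * ((-1) ^ n :: int poly)"
    using mn by (simp flip: power_add)
  ultimately have "Q * ((-1) ^ n * ?B) = (-1) ^ (m - n) * ?D * ((-1) ^ n * ?B)"
    by (simp add: mult_ac)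
  moreover have "(-1) ^ n * ?B \<noteq> 0" using B0 by simp
  ultimately show ?thesis by simp
qed

lemma Delta_pos: "x \<in># Delta m n a b \<Longrightarrow> x > 0"
  using zero_notin_sum_divs[OF _ a] by (cases "x = 0") (auto simp: Delta_def dest!: in_diffD)

lemma one_in_Delta_iff: "1 \<in># Delta m n a b \<longleftrightarrow> m \<noteq> n"
proof -
  have "count (Delta m n a b) 1 = m - n"
    unfolding Delta_def count_diff using a b by (simp add: count_sum_divs)
  thus ?thesis using mn by (metis count_greater_zero_iff diff_is_0_eq le_antisym neq0_conv zero_less_diff)
qed

end

theorem proposition4p1:
  fixes a b :: "nat \<Rightarrow> nat" and m n :: nat and Q :: "int poly"
  assumes "\<forall>i\<in>{1..m}. a i > 0" and "\<forall>j\<in>{1..n}. b j > 0" and "m \<ge> n"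
    and "Q * (\<Prod>j=1..n. 1 - monom 1 (b j)) = (\<Prod>i=1..m. 1 - monom 1 (a i))"
  shows
    \<comment> \<open>the two parenthetical equivalences\<close>
    "(\<forall>p I. prime p \<longrightarrow>
        (principal_ideal I \<and> p \<notin> I \<longleftrightarrow> (\<exists>d>0. \<not> p dvd d \<and> I = divs d)))
     \<and> (\<forall>x>0. \<forall>y>0. divs x \<subseteq> divs y \<longleftrightarrow> x dvd y)
     \<comment> \<open>1\<close>
     \<and> (condition_1 (Delta m n a b) \<longrightarrow> nonneg Q)
     \<comment> \<open>2; fails for \<open>m > n\<close>, where \<open>Q\<close> is nonzero but vanishes at 1\<close>
     \<and> (m = n \<and> condition_2 (Delta m n a b) \<longrightarrow> nonneg Q)
     \<comment> \<open>3\<close>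
     \<and> (\<forall>f. condition_3 m n a b f \<longrightarrow>
          nonneg Q \<and>
          (\<exists>R. Q = (\<Prod>j=1..n. R j) \<and>
            (\<forall>j\<in>{1..n}. R j * (1 - monom 1 (b j)) = 1 - monom 1 (a (f j)) \<and>
               nonneg (R j) \<and> flat (R j))))
     \<comment> \<open>(i)\<close>
     \<and> (\<forall>\<D>. condition_i (Delta m n a b) \<D> \<longrightarrow>
          Q = (-1) ^ (m - n) * (\<Prod>S\<in>#\<D>. \<Prod>x\<in>S. cyclotomic x) \<and>
          (\<forall>S\<in>#\<D>. flat_local_quotients S))
     \<comment> \<open>local versions, for the local quotients given by a decomposition of the multiset\<close>
     \<and> (\<forall>\<M>. Delta m n a b = \<Sum>\<^sub># \<M> \<longrightarrow>
          Q = (-1) ^ (m - n) * (\<Prod>M\<in>#\<M>. \<Prod>x\<in>#M. cyclotomic x) \<and>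
          (\<forall>M\<in>#\<M>.
             (condition_1 M \<longrightarrow> nonneg (\<Prod>x\<in>#M. cyclotomic x)) \<and>
             (1 \<notin># M \<and> condition_2 M \<longrightarrow> nonneg (\<Prod>x\<in>#M. cyclotomic x)) \<and>
             (local_condition_3 M \<longrightarrow>
                nonneg (\<Prod>x\<in>#M. cyclotomic x) \<and> flat (\<Prod>x\<in>#M. cyclotomic x)) \<and>
             (\<forall>\<D>. condition_i M \<D> \<longrightarrow> (\<forall>S\<in>#\<D>. flat_local_quotients S))) \<and>
          ((\<forall>M\<in>#\<M>. condition_1 M \<or> (1 \<notin># M \<and> condition_2 M) \<or> local_condition_3 M)
             \<longrightarrow> nonneg Q))"
proof -
  note factorization = quotient_eq_prod_Delta[OF assms]
  note pos = Delta_pos[OF assms]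
  have no_1: "m = n \<and> Q = (\<Prod>x\<in>#Delta m n a b. cyclotomic x)" if "1 \<notin># Delta m n a b"
    using one_in_Delta_iff[OF assms] factorization that by auto
  have ideals: "principal_ideal I \<and> p \<notin> I \<longleftrightarrow> (\<exists>d>0. \<not> p dvd d \<and> I = divs d)" for p I
    unfolding principal_ideal_def divs_def by (metis dvd_0_right gr0I mem_Collect_eq)
  have cond_1: "nonneg Q" if "condition_1 (Delta m n a b)"
    using that no_1 condition_1_not_1 condition_1_nonneg by metis
  have cond_2: "nonneg Q" if "m = n" "condition_2 (Delta m n a b)"
  proof -
    have no: "1 \<notin># Delta m n a b" using that one_in_Delta_iff[OF assms] by simp
    have "x > 1" if "x \<in># Delta m n a b" for x
      using no that pos[OF that] by (cases "x = 1") auto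
    with that show ?thesis using condition_2_nonneg no_1[OF no] by metis
  qed
  have cond_3: "nonneg Q \<and> (\<exists>R. Q = (\<Prod>j=1..n. R j) \<and>
      (\<forall>j\<in>{1..n}. R j * (1 - monom 1 (b j)) = 1 - monom 1 (a (f j)) \<and> nonneg (R j) \<and> flat (R j)))"
    if f: "condition_3 m n a b f" for f
  proof -
    have bij: "bij_betw f {1..n} {1..m}" and dvd: "\<And>j. j \<in> {1..n} \<Longrightarrow> b j dvd a (f j)"
      using f by (auto simp: condition_3_def divs_subset_iff)
    define R where "R j = (\<Prod>x\<in>divs (a (f j)) - divs (b j). cyclotomic x)" for j
    have af: "a (f j) > 0" if "j \<in> {1..n}" for j
      using bij that assms(1) by (auto simp: bij_betw_def)
    have R: "R j * (1 - monom 1 (b j)) = 1 - monom 1 (a (f j))" "nonneg (R j)" "flat (R j)"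
      if "j \<in> {1..n}" for j
      using prod_cyclotomic_diff[OF af[OF that] dvd[OF that]]
        diff_divs_nonneg_flat[OF af[OF that] dvd[OF that]]
      by (simp_all add: R_def algebra_simps)
    have B0: "(\<Prod>j=1..n. 1 - monom 1 (b j)) \<noteq> (0 :: int poly)"
      using assms(2) monom_minus_1_neq_0[where 'a=int] by (auto simp: eq_commute[of 1])
    have "(\<Prod>j=1..n. R j) * (\<Prod>j=1..n. 1 - monom 1 (b j)) = (\<Prod>j=1..n. 1 - monom 1 (a (f j)))"
      unfolding prod.distrib[symmetric] by (rule prod.cong) (use R in auto)
    also have "\<dots> = (\<Prod>i=1..m. 1 - monom 1 (a i))"
      using prod.reindex_bij_betw[OF bij, of "\<lambda>i. 1 - monom 1 (a i) :: int poly"] .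
    finally have "(\<Prod>j=1..n. R j) * (\<Prod>j=1..n. 1 - monom 1 (b j)) =
        Q * (\<Prod>j=1..n. 1 - monom 1 (b j))" using assms(4) by simp
    hence "Q = (\<Prod>j=1..n. R j)" using B0 by simp
    moreover from this have "nonneg Q" using R(2) by (auto intro: nonneg_prod)
    ultimately show ?thesis using R by blast
  qed
  have cond_i: "Q = (-1) ^ (m - n) * (\<Prod>S\<in>#\<D>. \<Prod>x\<in>S. cyclotomic x) \<and>
      (\<forall>S\<in>#\<D>. flat_local_quotients S)" if "condition_i (Delta m n a b) \<D>" for \<D>
  proof
    have "disjoint_multiset_union (Delta m n a b) \<D>" using that by (simp add: condition_i_def)
    thus "Q = (-1) ^ (m - n) * (\<Prod>S\<in>#\<D>. \<Prod>x\<in>S. cyclotomic x)"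
      using factorization prod_mset_disjoint_multiset_union by metis
    show "\<forall>S\<in>#\<D>. flat_local_quotients S"
      using condition_i_flat_local_quotients[OF that] pos by blast
  qed
  have local: "Q = (-1) ^ (m - n) * (\<Prod>M\<in>#\<M>. \<Prod>x\<in>#M. cyclotomic x) \<and>
      (\<forall>M\<in>#\<M>.
         (condition_1 M \<longrightarrow> nonneg (\<Prod>x\<in>#M. cyclotomic x)) \<and>
         (1 \<notin># M \<and> condition_2 M \<longrightarrow> nonneg (\<Prod>x\<in>#M. cyclotomic x)) \<and>
         (local_condition_3 M \<longrightarrow>
            nonneg (\<Prod>x\<in>#M. cyclotomic x) \<and> flat (\<Prod>x\<in>#M. cyclotomic x)) \<and>
         (\<forall>\<D>. condition_i M \<D> \<longrightarrow> (\<forall>S\<in>#\<D>. flat_local_quotients S))) \<and>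
      ((\<forall>M\<in>#\<M>. condition_1 M \<or> (1 \<notin># M \<and> condition_2 M) \<or> local_condition_3 M)
         \<longrightarrow> nonneg Q)" if Delta: "Delta m n a b = \<Sum>\<^sub># \<M>" for \<M>
  proof -
    have prod: "(\<Prod>x\<in>#Delta m n a b. cyclotomic x) = (\<Prod>M\<in>#\<M>. \<Prod>x\<in>#M. cyclotomic x)"
      by (simp add: Delta prod_mset_Union_mset)
    have M_pos: "x > 0" if "M \<in># \<M>" "x \<in># M" for M x
      using that pos[of x] Delta by auto
    have l2: "nonneg (\<Prod>x\<in>#M. cyclotomic x)" if "M \<in># \<M>" "1 \<notin># M" "condition_2 M" for M
    proof (rule condition_2_nonneg[OF that(3)])
      fix x assume "x \<in># M"
      thus "x > 1" using M_pos[OF that(1)] that(2) by (metis One_nat_def Suc_lessI)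
    qed
    have li: "flat_local_quotients S" if "M \<in># \<M>" "condition_i M \<D>" "S \<in># \<D>" for M \<D> S
      using condition_i_flat_local_quotients[OF that(2,3)] M_pos[OF that(1)] by blast
    have all: "nonneg Q"
      if *: "\<forall>M\<in>#\<M>. condition_1 M \<or> (1 \<notin># M \<and> condition_2 M) \<or> local_condition_3 M"
    proof -
      have "1 \<notin># M" if "M \<in># \<M>" for M
        using * that condition_1_not_1 local_condition_3_not_1 by blast
      hence "1 \<notin># Delta m n a b" unfolding Delta by auto
      hence "Q = (\<Prod>M\<in>#\<M>. \<Prod>x\<in>#M. cyclotomic x)" using no_1 prod by simp
      moreover have "nonneg (\<Prod>x\<in>#M. cyclotomic x)" if "M \<in># \<M>" for M
        using * that condition_1_nonneg l2 local_condition_3_nonneg_flat(1) by blast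
      ultimately show ?thesis using nonneg_prod_mset by metis
    qed
    show ?thesis
      using factorization prod condition_1_nonneg l2 local_condition_3_nonneg_flat li all by auto
  qed
  show ?thesis
    using ideals divs_subset_iff cond_1 cond_2 cond_3 cond_i local by blast
qed

end
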